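(* Let $\mathbb F\in\{\mathbb R,\mathbb C\}$ and let $\mathcal X$ be a finite-dimensional normed space over $\mathbb F$. A collection of vertices $\mathcal F\subseteq\Gamma(\mathcal X)$ forms a maximal face of $\mathbb P(\mathcal X)$ if and only if the following conditions are satisfied: (i) $\bigcap_{x\in\mathcal F}x^\perp$ contains $z^\perp$ for some $z\in\Gamma(\mathcal X)$; (ii) for every $y\in\Gamma(\mathcal X)\setminus\mathcal F$, the collection $\mathcal F\cup\{y\}$ does not satisfy (i), i.e. $\bigcap_{x\in\mathcal F\cup\{y\}}x^\perp$ contains no $z^\perp$ with $z\in\Gamma(\mathcal X)$.
   Context: For $u,v\in\mathcal X$, $u\perp v$ (Birkhoff--James orthogonality) means $\|u+\lambda v\|\ge\|u\|$ for all $\lambda\in\mathbb F$. $\Gamma(\mathcal X)$ is the directed graph whose vertex set is $\mathbb P(\mathcal X)=\{[u]=\mathbb F u : u\in\mathcal X\setminus\{0\}\}$, with an edge $[u]\rightarrow[v]$ if and only if $u\perp v$. For a vertex $x$, $x^\perp=\{y\in\Gamma(\mathcal X) : x\rightarrow y\}$. A face of the norm's unit ball is a (nonempty) convex subset $F$ of the unit sphere such that if $u,v$ are distinct normalized vectors whose open line segment $\{\lambda u+(1-\lambda)v : 0<\lambda<1\}$ intersects $F$, then $u,v\in F$. A subset $\mathcal F\subseteq\mathbb P(\mathcal X)$ is a face if one can choose a representative of each element of $\mathcal F$ so that the set of these representatives is a face of the unit ball of $\mathcal X$. A face is maximal if it is not properly contained in a bigger face. *)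

theory Defs
  imports "HOL-Analysis.Analysis" "Graph_Theory.Pair_Digraph"
begin

(* The scalar field is the type 'k; only the instances real and complex are of interest.
   The class real_normed_vector supplies the norm and the underlying real normed space; for
   'k = complex the locale says that it carries a compatible complex structure, and for
   'k = real its axiom smul_of_real forces smul to be scaleR. *)
locale fin_dim_normed_space = vector_space smul
  for smul :: "'k::real_normed_field \<Rightarrow> 'a::real_normed_vector \<Rightarrow> 'a" +
  assumes smul_of_real: "smul (of_real r) u = r *\<^sub>R u"
    and norm_smul: "norm (smul c u) = norm c * norm u"
    and finite_dimensional: "\<exists>B. finite_dimensional_vector_space smul B"

definition bj_orthogonal ::
    "('k::real_normed_field \<Rightarrow> 'a::real_normed_vector \<Rightarrow> 'a) \<Rightarrow> 'a \<Rightarrow> 'a \<Rightarrow> bool" where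
  "bj_orthogonal smul u v \<longleftrightarrow> (\<forall>c. norm (u + smul c v) \<ge> norm u)"

definition proj_point ::
    "('k::real_normed_field \<Rightarrow> 'a::real_normed_vector \<Rightarrow> 'a) \<Rightarrow> 'a \<Rightarrow> 'a set" where
  "proj_point smul u = range (\<lambda>c. smul c u)"

definition proj_space ::
    "('k::real_normed_field \<Rightarrow> 'a::real_normed_vector \<Rightarrow> 'a) \<Rightarrow> 'a set set" where
  "proj_space smul = {proj_point smul u |u. u \<noteq> 0}"

(* Whether two points are joined does not depend on the chosen representatives; see
   bj_graph_arc_iff below. *)
definition bj_graph ::
    "('k::real_normed_field \<Rightarrow> 'a::real_normed_vector \<Rightarrow> 'a) \<Rightarrow> 'a set pair_pre_digraph" where
  "bj_graph smul =
     \<lparr> pverts = proj_space smul,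
       parcs = {(proj_point smul u, proj_point smul v) |u v.
                  u \<noteq> 0 \<and> v \<noteq> 0 \<and> bj_orthogonal smul u v} \<rparr>"

definition out_perp :: "'v pair_pre_digraph \<Rightarrow> 'v \<Rightarrow> 'v set" where
  "out_perp G x = {y \<in> pverts G. (x, y) \<in> parcs G}"

definition ball_face :: "'a::real_normed_vector set \<Rightarrow> bool" where
  "ball_face F \<longleftrightarrow>
     F \<noteq> {} \<and> convex F \<and> F \<subseteq> sphere 0 1 \<and>
     (\<forall>u \<in> sphere 0 1. \<forall>v \<in> sphere 0 1.
        u \<noteq> v \<and> open_segment u v \<inter> F \<noteq> {} \<longrightarrow> u \<in> F \<and> v \<in> F)"

definition proj_face ::
    "('k::real_normed_field \<Rightarrow> 'a::real_normed_vector \<Rightarrow> 'a) \<Rightarrow> 'a set set \<Rightarrow> bool" where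
  "proj_face smul F \<longleftrightarrow>
     F \<subseteq> proj_space smul \<and>
     (\<exists>r. (\<forall>x\<in>F. r x \<noteq> 0 \<and> proj_point smul (r x) = x) \<and> ball_face (r ` F))"

definition maximal_proj_face ::
    "('k::real_normed_field \<Rightarrow> 'a::real_normed_vector \<Rightarrow> 'a) \<Rightarrow> 'a set set \<Rightarrow> bool" where
  "maximal_proj_face smul F \<longleftrightarrow>
     proj_face smul F \<and> \<not> (\<exists>F'. proj_face smul F' \<and> F \<subset> F')"

context fin_dim_normed_space
begin

lemma proj_point_eqD:
  assumes "proj_point smul u = proj_point smul v" "v \<noteq> 0"
  obtains a where "a \<noteq> 0" "v = smul a u"
proof -
  have "v \<in> proj_point smul v"
    unfolding proj_point_def by (rule range_eqI[of _ _ 1]) simp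
  then obtain a where "v = smul a u"
    using assms(1) unfolding proj_point_def by (metis imageE)
  with \<open>v \<noteq> 0\<close> show thesis using that by (cases "a = 0") auto
qed

lemma bj_orthogonal_smul:
  assumes "bj_orthogonal smul u v" "a \<noteq> 0"
  shows "bj_orthogonal smul (smul a u) (smul b v)"
  unfolding bj_orthogonal_def
proof
  fix c
  have "smul a u + smul c (smul b v) = smul a (u + smul (c * b / a) v)"
    using \<open>a \<noteq> 0\<close> by (simp add: scale_right_distrib)
  then have "norm (smul a u + smul c (smul b v)) = norm a * norm (u + smul (c * b / a) v)"
    by (simp add: norm_smul)
  also have "\<dots> \<ge> norm a * norm u"
    using assms(1) by (intro mult_left_mono) (auto simp: bj_orthogonal_def)
  finally show "norm (smul a u) \<le> norm (smul a u + smul c (smul b v))"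
    by (simp add: norm_smul)
qed

lemma bj_graph_arc_iff:
  assumes "u \<noteq> 0" "v \<noteq> 0"
  shows "(proj_point smul u, proj_point smul v) \<in> parcs (bj_graph smul)
           \<longleftrightarrow> bj_orthogonal smul u v"
proof
  assume "(proj_point smul u, proj_point smul v) \<in> parcs (bj_graph smul)"
  then obtain u' v' where "proj_point smul u' = proj_point smul u"
      "proj_point smul v' = proj_point smul v" "bj_orthogonal smul u' v'"
    unfolding bj_graph_def by auto
  then show "bj_orthogonal smul u v"
    by (metis assms proj_point_eqD bj_orthogonal_smul)
next
  assume "bj_orthogonal smul u v"
  then show "(proj_point smul u, proj_point smul v) \<in> parcs (bj_graph smul)"
    using assms unfolding bj_graph_def by auto
qed

end

end

theory Submission
  imports Defs
begin

text \<open>If \<open>f\<close> is a norm-one functional with \<open>f z = 1 = \<parallel>z\<parallel>\<close>, then \<open>ker f \<subseteq> z\<^sup>\<bottom>\<close>, so \<open>z\<^sup>\<bottom> \<subseteq> x\<^sup>\<bottom>\<close> with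
  \<open>\<parallel>x\<parallel> = 1\<close> forces \<open>\<bar>f x\<bar> = 1\<close>: every collection satisfying (i) lies in the exposed face \<open>{f = 1}\<close>.
  Conversely, a face has a relative interior point \<open>z\<close>, and \<open>z\<^sup>\<bottom> \<subseteq> x\<^sup>\<bottom>\<close> for all \<open>x\<close> in the face, so faces satisfy (i). The
  collections maximal with respect to (i) are therefore exactly the maximal faces.\<close>

section \<open>Supporting functionals\<close>

text \<open>Only nonnegative scalars are pulled out: the norm is symmetric, but its minorants
  constructed below need not be.\<close>

definition sublinear :: "('a::real_vector \<Rightarrow> real) \<Rightarrow> bool" where
  "sublinear p \<longleftrightarrow> (\<forall>x y. p (x + y) \<le> p x + p y) \<and> (\<forall>r x. r \<ge> 0 \<longrightarrow> p (r *\<^sub>R x) = r * p x)"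

lemma sublinear_add: "sublinear p \<Longrightarrow> p (x + y) \<le> p x + p y"
  and sublinear_scaleR: "sublinear p \<Longrightarrow> r \<ge> 0 \<Longrightarrow> p (r *\<^sub>R x) = r * p x"
  by (auto simp: sublinear_def)

lemma sublinear_zero: "sublinear p \<Longrightarrow> p 0 = 0"
  using sublinear_scaleR[of p 0 0] by simp

lemma sublinear_minus: "sublinear p \<Longrightarrow> - p x \<le> p (- x)"
  using sublinear_add[of p x "- x"] sublinear_zero[of p] by simp

text \<open>Minorizing a sublinear functional by one that is linear along a given vector, for each vector
  of a finite spanning set in turn, replaces the Hahn--Banach theorem.\<close>

lemma sublinear_minorant_linear_along:
  assumes p: "sublinear p"
  obtains q where "sublinear q" "\<And>x. q x \<le> p x" "q (- b) \<le> - p b"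
proof -
  \<comment> \<open>By subadditivity \<open>p (x + t b) - t * p b\<close> is nonincreasing in
    \<open>t\<close>. Its infimum \<open>q x\<close> is therefore its limit, the one-sided
    directional derivative of \<open>p\<close> at \<open>b\<close> in direction \<open>x\<close>.
    The choice \<open>t = 0\<close> gives \<open>q x <= p x\<close>, and \<open>t = 1\<close> at
    \<open>x = -b\<close> gives linearity along \<open>b\<close>.\<close>
  define S where "S x = (\<lambda>t. p (x + t *\<^sub>R b) - t * p b) ` {0..}" for x
  define q where "q x = Inf (S x)" for x
  have lower: "- p (- x) \<le> p (x + t *\<^sub>R b) - t * p b" if "t \<ge> 0" for x t
    using sublinear_add[OF p, of "x + t *\<^sub>R b" "- x"] sublinear_scaleR[OF p that, of b] by simp
  have bdd: "bdd_below (S x)" for x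
    unfolding S_def using lower by (intro bdd_belowI[of _ "- p (- x)"]) auto
  have ne: "S x \<noteq> {}" for x
    by (simp add: S_def)
  have q_le: "q x \<le> p (x + t *\<^sub>R b) - t * p b" if "t \<ge> 0" for x t
    unfolding q_def using that by (intro cInf_lower bdd) (auto simp: S_def)
  have le_q: "c \<le> q x" if "\<And>t. t \<ge> 0 \<Longrightarrow> c \<le> p (x + t *\<^sub>R b) - t * p b" for c x
    unfolding q_def using that by (intro cInf_greatest ne) (auto simp: S_def)
  have add: "q (x + y) \<le> q x + q y" for x y
  proof -
    \<comment> \<open>The two infima are taken one at a time, first over \<open>t\<close> with
      \<open>s\<close> fixed, then over \<open>s\<close>; the parameter \<open>t + s\<close> is
      tested for \<open>x + y\<close>.\<close>
    have "q (x + y) - (p (y + s *\<^sub>R b) - s * p b) \<le> q x" if "s \<ge> 0" for s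
    proof (rule le_q)
      fix t :: real assume "t \<ge> 0"
      have "q (x + y) \<le> p (x + y + (t + s) *\<^sub>R b) - (t + s) * p b"
        using \<open>t \<ge> 0\<close> \<open>s \<ge> 0\<close> by (intro q_le) simp
      also have "x + y + (t + s) *\<^sub>R b = (x + t *\<^sub>R b) + (y + s *\<^sub>R b)"
        by (simp add: algebra_simps)
      also have "p \<dots> - (t + s) * p b \<le> (p (x + t *\<^sub>R b) - t * p b) + (p (y + s *\<^sub>R b) - s * p b)"
        using sublinear_add[OF p, of "x + t *\<^sub>R b" "y + s *\<^sub>R b"] by (simp add: algebra_simps)
      finally show "q (x + y) - (p (y + s *\<^sub>R b) - s * p b) \<le> p (x + t *\<^sub>R b) - t * p b"
        by simp
    qed
    then have "q (x + y) - q x \<le> q y"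
      by (intro le_q) (simp add: algebra_simps)
    then show ?thesis by simp
  qed
  have scale_le: "r * q x \<le> q (r *\<^sub>R x)" if "r > 0" for r x
  proof (rule le_q)
    fix t :: real assume "t \<ge> 0"
    have "r * q x \<le> r * (p (x + (t / r) *\<^sub>R b) - (t / r) * p b)"
      using \<open>t \<ge> 0\<close> that by (intro mult_left_mono q_le) auto
    also have "\<dots> = p (r *\<^sub>R (x + (t / r) *\<^sub>R b)) - t * p b"
      using that by (simp add: sublinear_scaleR[OF p] right_diff_distrib)
    finally show "r * q x \<le> p (r *\<^sub>R x + t *\<^sub>R b) - t * p b"
      using that by (simp add: scaleR_add_right)
  qed
  have q0: "q 0 = 0"
  proof (rule antisym)
    show "q 0 \<le> 0" using q_le[of 0 0] by (simp add: sublinear_zero[OF p])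
    show "0 \<le> q 0" by (rule le_q) (simp add: sublinear_scaleR[OF p])
  qed
  have scale: "q (r *\<^sub>R x) = r * q x" if "r \<ge> 0" for r x
  proof (cases "r = 0")
    case False
    with that have "r > 0" by simp
    \<comment> \<open>The reverse inequality is \<open>scale_le\<close> for the factor
      \<open>1 / r\<close> at the vector \<open>r x\<close>.\<close>
    then have "inverse r * q (r *\<^sub>R x) \<le> q x"
      using scale_le[of "inverse r" "r *\<^sub>R x"] by simp
    then have "q (r *\<^sub>R x) \<le> r * q x"
      using \<open>r > 0\<close> by (simp add: field_simps)
    with scale_le[OF \<open>r > 0\<close>] show ?thesis by (intro antisym)
  qed (simp add: q0)
  show thesis
  proof
    show "sublinear q" unfolding sublinear_def using add scale by blast
    show "q x \<le> p x" for x using q_le[of 0 x] by simp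
    show "q (- b) \<le> - p b" using q_le[of 1 "- b"] by (simp add: sublinear_zero[OF p])
  qed
qed

text \<open>Linearity along \<open>c\<close> survives every further minorization: if
  \<open>q' <= q\<close>, then \<open>q' (-c) <= q (-c) <= - q c <= - q' c\<close>. Hence the
  vectors of \<open>B\<close> can be treated successively.\<close>

lemma sublinear_minorant_linear_along_finite:
  assumes "finite B" "sublinear p"
  obtains q where "sublinear q" "\<And>x. q x \<le> p x" "\<And>b. b \<in> B \<Longrightarrow> q (- b) \<le> - q b"
proof -
  from assms(1) have "\<exists>q. sublinear q \<and> (\<forall>x. q x \<le> p x) \<and> (\<forall>b\<in>B. q (- b) \<le> - q b)"
  proof (induction B rule: finite_induct)
    case empty
    then show ?case using assms(2) by auto
  next
    case (insert b B)
    then obtain q where q: "sublinear q" "\<And>x. q x \<le> p x" "\<And>b. b \<in> B \<Longrightarrow> q (- b) \<le> - q b"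
      by blast
    obtain q' where q': "sublinear q'" "\<And>x. q' x \<le> q x" "q' (- b) \<le> - q b"
      using sublinear_minorant_linear_along[OF q(1)] by blast
    have "q' x \<le> p x" for x
      using q(2)[of x] q'(2)[of x] by simp
    moreover have "q' (- b) \<le> - q' b"
      using q'(2)[of b] q'(3) by simp
    moreover have "q' (- c) \<le> - q' c" if "c \<in> B" for c
      using q(3)[OF that] q'(2)[of c] q'(2)[of "- c"] by simp
    ultimately show ?case using q'(1) by blast
  qed
  with that show thesis by blast
qed

text \<open>The vectors with \<open>q (-x) <= - q x\<close> form a subspace, so \<open>q\<close> is
  odd everywhere. Subadditivity at \<open>-x\<close> and \<open>-y\<close> then reverses the
  inequality at \<open>x\<close> and \<open>y\<close>.\<close>

lemma sublinear_imp_linear: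
  assumes q: "sublinear q" and B: "span B = UNIV" "\<And>b. b \<in> B \<Longrightarrow> q (- b) \<le> - q b"
  shows "linear q"
proof -
  have "subspace {x. q (- x) \<le> - q x}"
    unfolding subspace_def
  proof (intro conjI allI ballI; clarsimp)
    show "q 0 \<le> 0" by (simp add: sublinear_zero[OF q])
  next
    fix x y assume "q (- x) \<le> - q x" "q (- y) \<le> - q y"
    then show "q (- x - y) \<le> - q (x + y)"
      using sublinear_add[OF q, of "- x" "- y"] sublinear_add[OF q, of x y] by simp
  next
    fix c x assume x: "q (- x) \<le> - q x"
    show "q (- (c *\<^sub>R x)) \<le> - q (c *\<^sub>R x)"
    proof (cases "c \<ge> 0")
      case True
      with sublinear_scaleR[OF q, of c x] sublinear_scaleR[OF q, of c "- x"]
        mult_left_mono[OF x True] show ?thesis by simp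
    next
      case False
      with sublinear_scaleR[OF q, of "- c" x] sublinear_scaleR[OF q, of "- c" "- x"]
        mult_left_mono[OF x, of "- c"] show ?thesis by simp
    qed
  qed
  then have "span B \<subseteq> {x. q (- x) \<le> - q x}"
    using B(2) by (intro span_minimal) auto
  then have neg: "q (- x) = - q x" for x
    using B(1) sublinear_minus[OF q, of x] by (force intro: antisym)
  show ?thesis
  proof (rule linearI)
    fix x y
    show "q (x + y) = q x + q y"
      using sublinear_add[OF q, of x y] sublinear_add[OF q, of "- x" "- y"]
        neg[of "x + y"] by (simp add: neg)
  next
    fix c x
    show "q (c *\<^sub>R x) = c *\<^sub>R q x"
    proof (cases "c \<ge> 0")
      case False
      then have "q ((- c) *\<^sub>R x) = (- c) * q x"
        by (intro sublinear_scaleR[OF q]) simp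
      then show ?thesis by (simp add: neg)
    qed (simp add: sublinear_scaleR[OF q])
  qed
qed

text \<open>Minorizing the norm along \<open>z\<close> first yields
  \<open>p (-z) <= - norm z\<close>. This bound passes to every smaller functional and forces the
  final linear \<open>g\<close> to attain \<open>norm z\<close> at \<open>z\<close>.\<close>

lemma real_supporting_functional:
  fixes z :: "'a::real_normed_vector"
  assumes "finite B" "span B = (UNIV :: 'a set)"
  obtains g where "linear g" "\<And>x. g x \<le> norm x" "g z = norm z"
proof -
  have "sublinear (norm :: 'a \<Rightarrow> real)"
    by (simp add: sublinear_def norm_triangle_ineq)
  then obtain p where p: "sublinear p" "\<And>x. p x \<le> norm x" "p (- z) \<le> - norm z"
    using sublinear_minorant_linear_along by metis
  obtain g where g: "sublinear g" "\<And>x. g x \<le> p x" "\<And>b. b \<in> B \<Longrightarrow> g (- b) \<le> - g b"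
    using sublinear_minorant_linear_along_finite[OF assms(1) p(1)] by metis
  have lin: "linear g"
    using sublinear_imp_linear[OF g(1) assms(2) g(3)] .
  have le: "g x \<le> norm x" for x
    using g(2) p(2) order_trans by blast
  have "g (- z) \<le> - norm z"
    using g(2) p(3) order_trans by blast
  then have "g z = norm z"
    using le[of z] linear_neg[OF lin, of z] by simp
  with that lin le show thesis by blast
qed

section \<open>Core points of convex subsets of the sphere\<close>

text \<open>The core point is the barycentre of a basis \<open>S \<subseteq> A\<close> of the span of \<open>A\<close>. That
  \<open>(1 - t) z + t x\<close> has norm 1 for small \<open>t > 0\<close> forces the coefficients of \<open>x\<close> to have sum at
  least 1.\<close>

lemma convex_subset_sphere_core_point:
  fixes A :: "'a::real_normed_vector set"
  assumes B: "finite B" "span B = (UNIV :: 'a set)"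
    and A: "convex A" "A \<noteq> {}" "A \<subseteq> sphere 0 1"
  obtains z where "z \<in> A" "\<And>x. x \<in> A \<Longrightarrow> \<exists>t>0. norm (z - t *\<^sub>R x) \<le> 1 - t"
proof -
  obtain S where S: "S \<subseteq> A" "independent S" "A \<subseteq> span S"
    using maximal_independent_subset[of A] by blast
  have fin: "finite S"
    using independent_span_bound[OF B(1) S(2)] B(2) by simp
  have "S \<noteq> {}"
    using A(2,3) S(3) by (force simp: span_empty)
  define n where "n = real (card S)"
  have "n > 0"
    using fin \<open>S \<noteq> {}\<close> by (simp add: n_def card_gt_0_iff)
  have norm1: "norm s = 1" if "s \<in> A" for s
    using that A(3) by auto
  have norm_comb: "norm (\<Sum>s\<in>S. c s *\<^sub>R s) \<le> sum c S" if "\<And>s. s \<in> S \<Longrightarrow> c s \<ge> 0" for c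
    using that S(1) norm1 by (intro order_trans[OF norm_sum] sum_mono) auto
  define z where "z = (\<Sum>s\<in>S. (1 / n) *\<^sub>R s)"
  have "z \<in> A"
    unfolding z_def using S(1) \<open>n > 0\<close>
    by (intro convex_sum[OF fin A(1)]) (auto simp: n_def)
  moreover have "\<exists>t>0. norm (z - t *\<^sub>R x) \<le> 1 - t" if "x \<in> A" for x
  proof -
    obtain u where x: "x = (\<Sum>s\<in>S. u s *\<^sub>R s)"
      using S(3) \<open>x \<in> A\<close> by (auto simp: span_finite[OF fin])
    define M where "M = (\<Sum>s\<in>S. \<bar>u s\<bar>)"
    have M: "\<bar>u s\<bar> \<le> M" if "s \<in> S" for s
      unfolding M_def using fin that by (intro member_le_sum) auto
    have "M \<ge> 0" by (simp add: M_def sum_nonneg)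
    \<comment> \<open>This makes \<open>t + n * t * M = 1\<close>, hence
      \<open>t * |u s| <= (1 - t) / n\<close>. So both \<open>(1 - t) z + t x\<close> and
      \<open>z - t x\<close> have nonnegative coefficients over \<open>S\<close>, as
      \<open>norm_comb\<close> demands.\<close>
    define t where "t = 1 / (1 + n * M)"
    have t: "0 < t" "t \<le> 1"
      using \<open>M \<ge> 0\<close> \<open>n > 0\<close> by (auto simp: t_def field_simps add_pos_nonneg)
    have tM: "t + n * (t * M) = 1"
      using \<open>M \<ge> 0\<close> \<open>n > 0\<close> by (simp add: t_def field_simps add_pos_nonneg add_nonneg_eq_0_iff)
    have tu: "n * (t * \<bar>u s\<bar>) \<le> 1 - t" if "s \<in> S" for s
    proof -
      have "n * (t * \<bar>u s\<bar>) \<le> n * (t * M)"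
        using M[OF that] t(1) \<open>n > 0\<close> by (intro mult_left_mono) auto
      with tM show ?thesis by linarith
    qed
    have sum1: "(\<Sum>s\<in>S. 1 / n) = 1" "(\<Sum>s\<in>S. (1 - t) / n) = 1 - t"
      using \<open>n > 0\<close> by (simp_all add: n_def)
    have "norm ((1 - t) *\<^sub>R z + t *\<^sub>R x) = 1"
      using convexD[OF A(1) \<open>z \<in> A\<close> \<open>x \<in> A\<close>, of "1 - t" t] t norm1 by simp
    moreover have "(1 - t) *\<^sub>R z + t *\<^sub>R x = (\<Sum>s\<in>S. ((1 - t) / n + t * u s) *\<^sub>R s)"
      by (simp add: z_def x scaleR_sum_right scaleR_add_left sum.distrib)
    moreover have "norm \<dots> \<le> (\<Sum>s\<in>S. (1 - t) / n + t * u s)"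
    proof (rule norm_comb)
      fix s assume "s \<in> S"
      have "n * (t * (- u s)) \<le> n * (t * \<bar>u s\<bar>)"
        using t(1) \<open>n > 0\<close> by (intro mult_left_mono) auto
      with tu[OF \<open>s \<in> S\<close>] show "(1 - t) / n + t * u s \<ge> 0"
        using \<open>n > 0\<close> by (simp add: field_simps)
    qed
    ultimately have "1 \<le> 1 - t + t * sum u S"
      by (simp add: sum.distrib sum1 del: sum_constant flip: sum_distrib_left)
    \<comment> \<open>The coefficients of \<open>z - t x\<close> sum to
      \<open>1 - t * sum u S\<close>, which is at most \<open>1 - t\<close> because the preceding
      inequality says \<open>sum u S >= 1\<close>.\<close>
    moreover have "norm (z - t *\<^sub>R x) \<le> 1 - t * sum u S"
    proof -
      have "z - t *\<^sub>R x = (\<Sum>s\<in>S. (1 / n - t * u s) *\<^sub>R s)"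
        by (simp add: z_def x scaleR_sum_right scaleR_diff_left sum_subtractf)
      also have "norm \<dots> \<le> (\<Sum>s\<in>S. 1 / n - t * u s)"
      proof (rule norm_comb)
        fix s assume "s \<in> S"
        have "n * (t * u s) \<le> n * (t * \<bar>u s\<bar>)"
          using t(1) \<open>n > 0\<close> by simp
        with tu[OF \<open>s \<in> S\<close>] have "n * (t * u s) \<le> 1"
          using t(1) by linarith
        then show "1 / n - t * u s \<ge> 0"
          using \<open>n > 0\<close> by (simp add: field_simps)
      qed
      finally show ?thesis
        by (simp add: sum_subtractf sum1 del: sum_constant flip: sum_distrib_left)
    qed
    ultimately have "norm (z - t *\<^sub>R x) \<le> 1 - t" by linarith
    with t(1) show ?thesis by blast
  qed
  ultimately show thesis by (rule that)
qed

section \<open>Exposed faces\<close>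

definition contractive_functional ::
    "('k::real_normed_field \<Rightarrow> 'a::real_normed_vector \<Rightarrow> 'a) \<Rightarrow> ('a \<Rightarrow> 'k) \<Rightarrow> bool" where
  "contractive_functional smul f \<longleftrightarrow>
     (\<forall>x y. f (x + y) = f x + f y) \<and> (\<forall>c x. f (smul c x) = c * f x) \<and> (\<forall>x. norm (f x) \<le> norm x)"

definition exposed_points ::
    "('k::real_normed_field \<Rightarrow> 'a::real_normed_vector \<Rightarrow> 'a) \<Rightarrow> ('a \<Rightarrow> 'k) \<Rightarrow> 'a set set" where
  "exposed_points smul f = proj_point smul ` {u. norm u = 1 \<and> f u = 1}"

text \<open>Condition (i). For empty \<open>F\<close> the intersection is the whole type, so the
  condition then says that a vertex exists; over the zero space it fails for every
  \<open>F\<close>.\<close>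

definition perp_bounded ::
    "('k::real_normed_field \<Rightarrow> 'a::real_normed_vector \<Rightarrow> 'a) \<Rightarrow> 'a set set \<Rightarrow> bool" where
  "perp_bounded smul F \<longleftrightarrow>
     (\<exists>z \<in> pverts (bj_graph smul).
        out_perp (bj_graph smul) z \<subseteq> (\<Inter>x\<in>F. out_perp (bj_graph smul) x))"

lemma pverts_bj_graph: "pverts (bj_graph smul) = proj_space smul"
  by (simp add: bj_graph_def)

lemma perp_bounded_mono: "perp_bounded smul F \<Longrightarrow> F' \<subseteq> F \<Longrightarrow> perp_bounded smul F'"
  unfolding perp_bounded_def by blast

text \<open>Extremality of 1 in the scalar unit ball, for real and complex scalars at once.
  Cauchy-Schwarz bounds the inner products with 1 by 1, so both attain it, and then
  \<open>norm (c - 1)^2 = norm c^2 - 1 <= 0\<close>.\<close>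

lemma convex_combination_eq_1:
  fixes a b :: "'k::{real_normed_field,real_inner}"
  assumes ab: "norm a \<le> 1" "norm b \<le> 1" "(1 - t) *\<^sub>R a + t *\<^sub>R b = 1" and t: "0 < t" "t < 1"
  shows "a = 1 \<and> b = 1"
proof -
  have le: "inner c 1 \<le> 1" if "norm c \<le> 1" for c :: 'k
    using norm_cauchy_schwarz[of c 1] that by simp
  have eq: "c = 1" if "norm c \<le> 1" "inner c 1 = 1" for c :: 'k
  proof -
    have "(norm (c - 1))\<^sup>2 = (norm c)\<^sup>2 - 1"
      using that(2) by (simp add: power2_norm_eq_inner inner_diff inner_commute[of 1 c])
         (simp add: flip: power2_norm_eq_inner)
    also have "\<dots> \<le> 0"
      using that(1) by (simp add: power_le_one)
    finally show ?thesis by simp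
  qed
  have "(1 - t) * inner a 1 + t * inner b 1 = inner ((1 - t) *\<^sub>R a + t *\<^sub>R b) 1"
    by (simp add: inner_add_left)
  also have "\<dots> = 1"
    by (simp add: ab(3) dot_square_norm)
  finally have "(1 - t) * (1 - inner a 1) + t * (1 - inner b 1) = 0"
    by (simp add: algebra_simps)
  moreover have "(1 - t) * (1 - inner a 1) \<ge> 0" "t * (1 - inner b 1) \<ge> 0"
    using le[OF ab(1)] le[OF ab(2)] t by simp_all
  ultimately have "(1 - t) * (1 - inner a 1) = 0" "t * (1 - inner b 1) = 0"
    by linarith+
  with t have "inner a 1 = 1" "inner b 1 = 1"
    by simp_all
  then show ?thesis using eq ab(1,2) by blast
qed

text \<open>The minorization and core point arguments are real. A finite real spanning set consists
  of the products \<open>e b\<close> with \<open>e\<close> in a real basis of the scalars and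
  \<open>b\<close> in a basis over them.\<close>

lemma finite_real_span:
  fixes smul :: "'k::{real_normed_field,euclidean_space} \<Rightarrow> 'a::real_normed_vector \<Rightarrow> 'a"
  assumes "fin_dim_normed_space smul"
  obtains C where "finite C" "span C = (UNIV :: 'a set)"
proof -
  interpret V: fin_dim_normed_space smul by fact
  obtain B where "finite_dimensional_vector_space smul B"
    using V.finite_dimensional by blast
  then interpret fd: finite_dimensional_vector_space smul B .
  define C where "C = (\<lambda>(e, b). smul e b) ` (Basis \<times> B)"
  have smul_in: "smul c b \<in> span C" if "b \<in> B" for c b
  proof -
    have "smul c b = (\<Sum>e\<in>Basis. smul ((c \<bullet> e) *\<^sub>R e) b)"
      by (simp add: euclidean_representation flip: V.scale_sum_left)
    also have "\<dots> = (\<Sum>e\<in>Basis. (c \<bullet> e) *\<^sub>R smul e b)"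
      by (simp add: scaleR_conv_of_real V.smul_of_real flip: V.scale_scale)
    also have "\<dots> \<in> span C"
      using that by (intro span_sum span_scale span_base) (auto simp: C_def)
    finally show ?thesis .
  qed
  have "x \<in> span C" for x
  proof -
    have "x \<in> V.span B" by (simp add: fd.span_Basis)
    then obtain u where "x = (\<Sum>b\<in>B. smul (u b) b)"
      by (auto simp: V.span_finite[OF fd.finite_Basis])
    then show ?thesis by (auto intro: span_sum smul_in)
  qed
  moreover have "finite C"
    by (simp add: C_def fd.finite_Basis)
  ultimately show thesis using that by blast
qed

text \<open>Scalar-valued norming functionals are the only ingredient obtained separately for real
  and complex scalars; with them assumed, the rest is uniform.\<close>

locale supported_normed_space = fin_dim_normed_space smul
  for smul :: "'k::{real_normed_field,euclidean_space} \<Rightarrow> 'a::real_normed_vector \<Rightarrow> 'a" +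
  assumes supporting_functional: "norm z = 1 \<Longrightarrow> \<exists>f. contractive_functional smul f \<and> f z = 1"
begin

section \<open>Unit representatives and inclusions between out-neighbourhoods\<close>

lemma proj_point_smul:
  assumes "a \<noteq> 0"
  shows "proj_point smul (smul a u) = proj_point smul u"
proof -
  have "smul c (smul a u) \<in> range (\<lambda>c. smul c u)" "smul c u \<in> range (\<lambda>c. smul c (smul a u))" for c
    using assms by (auto intro: range_eqI[of _ _ "c * a"] range_eqI[of _ _ "c / a"])
  then show ?thesis unfolding proj_point_def by blast
qed

lemma proj_space_unit_vector:
  assumes "x \<in> proj_space smul"
  obtains u where "norm u = 1" "x = proj_point smul u"
proof -
  obtain v where v: "v \<noteq> 0" "x = proj_point smul v"
    using assms by (auto simp: proj_space_def)
  then have "proj_point smul (smul (of_real (1 / norm v)) v) = x"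
    by (subst proj_point_smul) auto
  moreover have "norm (smul (of_real (1 / norm v)) v) = 1"
    using v(1) by (simp add: norm_smul norm_divide)
  ultimately show thesis using that by metis
qed

lemma proj_point_in_proj_space: "norm u = 1 \<Longrightarrow> proj_point smul u \<in> proj_space smul"
  by (force simp: proj_space_def)

lemma out_perp_subset_iff:
  assumes "u \<noteq> 0" "x \<noteq> 0"
  shows "out_perp (bj_graph smul) (proj_point smul u) \<subseteq> out_perp (bj_graph smul) (proj_point smul x)
           \<longleftrightarrow> (\<forall>v. bj_orthogonal smul u v \<longrightarrow> bj_orthogonal smul x v)"
    (is "?L \<longleftrightarrow> ?R")
proof -
  have mem: "proj_point smul v \<in> out_perp (bj_graph smul) (proj_point smul w) \<longleftrightarrow>
      bj_orthogonal smul w v" if "v \<noteq> 0" "w \<noteq> 0" for v w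
    using that by (auto simp: out_perp_def bj_graph_arc_iff) (auto simp: bj_graph_def proj_space_def)
  \<comment> \<open>The vector 0 represents no vertex, so the graph inclusion does not cover
    \<open>v = 0\<close>.\<close>
  have zero: "bj_orthogonal smul x 0"
    by (simp add: bj_orthogonal_def)
  show ?thesis
  proof
    assume ?L
    then show ?R using mem zero assms by (metis subsetD)
  next
    assume ?R
    moreover have "\<exists>v. v \<noteq> 0 \<and> y = proj_point smul v"
      if "y \<in> out_perp (bj_graph smul) (proj_point smul u)" for y
      using that by (auto simp: out_perp_def bj_graph_def proj_space_def)
    ultimately show ?L using mem assms by (metis subsetI)
  qed
qed

text \<open>With \<open>t (x + c v) + (z - t x) = z + t c v\<close>, a vector \<open>x + c v\<close> shorter than \<open>x\<close>
  would make \<open>z + t c v\<close> shorter than \<open>z\<close>.\<close>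

lemma bj_orthogonal_core_point:
  assumes z: "bj_orthogonal smul z v" "norm z = 1" and x: "norm x = 1"
    and t: "t > 0" "norm (z - t *\<^sub>R x) \<le> 1 - t"
  shows "bj_orthogonal smul x v"
  unfolding bj_orthogonal_def
proof
  fix c
  have "1 \<le> norm (z + smul (of_real t * c) v)"
    using z by (simp add: bj_orthogonal_def)
  also have "z + smul (of_real t * c) v = (z - t *\<^sub>R x) + t *\<^sub>R (x + smul c v)"
    by (simp add: scaleR_add_right smul_of_real flip: scale_scale)
  also have "norm \<dots> \<le> (1 - t) + t * norm (x + smul c v)"
    using t by (intro order_trans[OF norm_triangle_ineq] add_mono) auto
  finally have "t * 1 \<le> t * norm (x + smul c v)" by simp
  with t(1) x show "norm x \<le> norm (x + smul c v)"
    by (simp only: mult_le_cancel_left_pos)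
qed

section \<open>Faces, exposed faces and condition (i)\<close>

lemma proj_face_perp_bounded:
  assumes "proj_face smul F"
  shows "perp_bounded smul F"
proof -
  obtain r where r: "\<And>x. x \<in> F \<Longrightarrow> r x \<noteq> 0" "\<And>x. x \<in> F \<Longrightarrow> proj_point smul (r x) = x"
      "ball_face (r ` F)"
    using assms by (auto simp: proj_face_def)
  then have A: "convex (r ` F)" "r ` F \<noteq> {}" "r ` F \<subseteq> sphere 0 1"
    by (auto simp: ball_face_def)
  obtain C where C: "finite C" "Real_Vector_Spaces.span C = (UNIV :: 'a set)"
    using finite_real_span[OF fin_dim_normed_space_axioms] by metis
  obtain z where z: "z \<in> r ` F" "\<And>x. x \<in> r ` F \<Longrightarrow> \<exists>t>0. norm (z - t *\<^sub>R x) \<le> 1 - t"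
    using convex_subset_sphere_core_point[OF C A] by blast
  have norm1: "norm x = 1" if "x \<in> r ` F" for x
    using that A(3) by auto
  have "out_perp (bj_graph smul) (proj_point smul z) \<subseteq> out_perp (bj_graph smul) x"
    if x: "x \<in> F" for x
  proof -
    obtain t where t: "t > 0" "norm (z - t *\<^sub>R r x) \<le> 1 - t"
      using z(2)[OF imageI[OF x]] by blast
    have "bj_orthogonal smul z v \<Longrightarrow> bj_orthogonal smul (r x) v" for v
      using bj_orthogonal_core_point[OF _ norm1[OF z(1)] norm1[OF imageI[OF x]] t] .
    moreover have "z \<noteq> 0" using norm1[OF z(1)] by auto
    ultimately show ?thesis
      using out_perp_subset_iff[of z "r x"] r(1,2)[OF x] by simp
  qed
  moreover have "proj_point smul z \<in> pverts (bj_graph smul)"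
    using proj_point_in_proj_space[OF norm1[OF z(1)]] by (simp add: bj_graph_def)
  ultimately show ?thesis unfolding perp_bounded_def by blast
qed

text \<open>The vector \<open>x - f x z\<close> lies in the kernel of \<open>f\<close>, hence in \<open>z\<^sup>\<bottom> \<subseteq> x\<^sup>\<bottom>\<close>; subtracting it
  from \<open>x\<close> leaves \<open>f x z\<close>.\<close>

lemma norm_functional_eq_1:
  assumes f: "contractive_functional smul f" "f z = 1"
    and z: "norm z = 1" and x: "norm x = 1"
    and perp: "\<And>v. bj_orthogonal smul z v \<Longrightarrow> bj_orthogonal smul x v"
  shows "norm (f x) = 1"
proof (rule antisym)
  have add: "f (u + v) = f u + f v" and scale: "f (smul c u) = c * f u" and le: "norm (f u) \<le> norm u"
    for u v c using f(1) by (auto simp: contractive_functional_def)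
  show "norm (f x) \<le> 1" using le[of x] x by simp
  define w where "w = x + smul (- f x) z"
  have "f w = 0" by (simp add: w_def add scale f(2) del: scale_minus_left)
  have "bj_orthogonal smul z w"
    unfolding bj_orthogonal_def
  proof
    fix c
    have "f (z + smul c w) = 1" by (simp add: add scale f(2) \<open>f w = 0\<close>)
    then show "norm z \<le> norm (z + smul c w)" using le[of "z + smul c w"] z by simp
  qed
  then have "norm x \<le> norm (x + smul (- 1) w)"
    using perp unfolding bj_orthogonal_def by blast
  also have "x + smul (- 1) w = smul (f x) z"
    by (simp add: w_def)
  finally show "1 \<le> norm (f x)" using x z by (simp add: norm_smul)
qed

lemma perp_bounded_imp_exposed:
  assumes F: "perp_bounded smul F" "F \<subseteq> proj_space smul"
  obtains f where "contractive_functional smul f" "\<exists>u. norm u = 1 \<and> f u = 1"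
    "F \<subseteq> exposed_points smul f"
proof -
  obtain z where z: "norm z = 1"
    "\<And>x. x \<in> F \<Longrightarrow> out_perp (bj_graph smul) (proj_point smul z) \<subseteq> out_perp (bj_graph smul) x"
  proof -
    obtain y where y: "y \<in> proj_space smul"
        "\<And>x. x \<in> F \<Longrightarrow> out_perp (bj_graph smul) y \<subseteq> out_perp (bj_graph smul) x"
      using F(1) by (auto simp: perp_bounded_def bj_graph_def)
    from y(1) obtain z where "norm z = 1" "y = proj_point smul z"
      by (rule proj_space_unit_vector)
    with y(2) that show thesis by blast
  qed
  obtain f where f: "contractive_functional smul f" "f z = 1"
    using supporting_functional[OF z(1)] by blast
  have "x \<in> exposed_points smul f" if "x \<in> F" for x
  proof -
    from F(2) that have "x \<in> proj_space smul" by blast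
    then obtain u where u: "norm u = 1" "x = proj_point smul u"
      by (rule proj_space_unit_vector)
    moreover have "u \<noteq> 0" "z \<noteq> 0" using u(1) z(1) by auto
    ultimately have fu: "norm (f u) = 1"
      using z(2)[OF that] by (intro norm_functional_eq_1[OF f z(1)]) (auto simp: out_perp_subset_iff)
    then have "f u \<noteq> 0" by auto
    \<comment> \<open>Only the modulus of \<open>f u\<close> is known to be 1; dividing by
      \<open>f u\<close> turns the value into 1 within the same projective point.\<close>
    let ?u = "smul (inverse (f u)) u"
    have "norm ?u = 1" using u(1) fu by (simp add: norm_smul norm_inverse)
    moreover have "f ?u = 1"
      using f(1) \<open>f u \<noteq> 0\<close> by (simp add: contractive_functional_def)
    moreover have "proj_point smul ?u = x"
      using u(2) \<open>f u \<noteq> 0\<close> by (simp add: proj_point_smul)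
    ultimately show ?thesis unfolding exposed_points_def by (metis (mono_tags, lifting) image_eqI mem_Collect_eq)
  qed
  with that f z(1) show thesis by blast
qed

text \<open>The equation \<open>f u = 1\<close> fixes the scalar, so each class has one
  representative in \<open>C\<close> and the inverse of \<open>proj_point\<close> on
  \<open>C\<close> chooses it. \<open>C\<close> is a face because 1 is extreme in the scalar unit
  ball.\<close>

lemma proj_face_exposed_points:
  assumes f: "contractive_functional smul f" and ne: "\<exists>u. norm u = 1 \<and> f u = 1"
  shows "proj_face smul (exposed_points smul f)"
proof -
  define C where "C = {u. norm u = 1 \<and> f u = 1}"
  have add: "f (u + v) = f u + f v" and scale: "f (smul c u) = c * f u" and le: "norm (f u) \<le> norm u"
    for u v c using f by (auto simp: contractive_functional_def)
  have scaleR: "f (r *\<^sub>R u) = r *\<^sub>R f u" for r u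
    using scale[of "of_real r" u] by (simp add: smul_of_real scaleR_conv_of_real)
  have inj: "inj_on (proj_point smul) C"
  proof (rule inj_onI)
    fix u v assume "u \<in> C" "v \<in> C" and eq: "proj_point smul u = proj_point smul v"
    then have "v \<noteq> 0" by (auto simp: C_def)
    then obtain a where "v = smul a u" using proj_point_eqD eq by blast
    with \<open>u \<in> C\<close> \<open>v \<in> C\<close> show "u = v" by (simp add: C_def scale)
  qed
  have "convex C"
    unfolding convex_alt
  proof (intro ballI allI impI)
    fix u v :: 'a and t :: real assume C: "u \<in> C" "v \<in> C" and t: "0 \<le> t \<and> t \<le> 1"
    let ?w = "(1 - t) *\<^sub>R u + t *\<^sub>R v"
    have "f ?w = 1" using C by (simp add: C_def add scaleR flip: scaleR_left.add)
    moreover have "norm ?w \<le> 1"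
      using C t norm_triangle_ineq[of "(1 - t) *\<^sub>R u" "t *\<^sub>R v"] by (simp add: C_def)
    ultimately show "?w \<in> C" using le[of ?w] by (simp add: C_def)
  qed
  moreover have "u \<in> C \<and> v \<in> C"
    if uv: "u \<in> sphere 0 1" "v \<in> sphere 0 1" "open_segment u v \<inter> C \<noteq> {}" for u v
  proof -
    obtain t where t: "0 < t" "t < 1" and "(1 - t) *\<^sub>R u + t *\<^sub>R v \<in> C"
      using uv(3) by (auto simp: in_segment)
    then have "(1 - t) *\<^sub>R f u + t *\<^sub>R f v = 1"
      by (simp add: C_def add scaleR)
    moreover have "norm (f u) \<le> 1" "norm (f v) \<le> 1"
      using le[of u] le[of v] uv(1,2) by auto
    ultimately have "f u = 1 \<and> f v = 1"
      using convex_combination_eq_1 t by blast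
    with uv(1,2) show ?thesis by (simp add: C_def)
  qed
  ultimately have "ball_face C"
    using ne unfolding ball_face_def by (auto simp: C_def)
  moreover have "exposed_points smul f = proj_point smul ` C"
    by (simp add: exposed_points_def C_def)
  moreover have "inv_into C (proj_point smul) ` proj_point smul ` C = C"
    using inj by (simp add: image_comp cong: image_cong)
  moreover have "inv_into C (proj_point smul) x \<noteq> 0 \<and> proj_point smul (inv_into C (proj_point smul) x) = x"
    if "x \<in> proj_point smul ` C" for x
    using inv_into_into[OF that] f_inv_into_f[OF that] by (auto simp: C_def)
  moreover have "proj_point smul ` C \<subseteq> proj_space smul"
    using proj_point_in_proj_space by (auto simp: C_def)
  ultimately show ?thesis
    unfolding proj_face_def by metis
qed

section \<open>Maximal faces as maximal collections satisfying (i)\<close>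

theorem maximal_proj_face_iff:
  assumes "F \<subseteq> proj_space smul"
  shows "maximal_proj_face smul F \<longleftrightarrow>
    perp_bounded smul F \<and> (\<forall>y \<in> proj_space smul - F. \<not> perp_bounded smul (F \<union> {y}))"
proof
  assume max: "maximal_proj_face smul F"
  then have "perp_bounded smul F"
    by (auto simp: maximal_proj_face_def proj_face_perp_bounded)
  moreover have "\<not> perp_bounded smul (F \<union> {y})" if y: "y \<in> proj_space smul - F" for y
  proof
    assume "perp_bounded smul (F \<union> {y})"
    moreover have "F \<union> {y} \<subseteq> proj_space smul" using y assms by blast
    ultimately obtain f where "contractive_functional smul f" "\<exists>u. norm u = 1 \<and> f u = 1"
      and sub: "F \<union> {y} \<subseteq> exposed_points smul f"
      by (rule perp_bounded_imp_exposed)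
    then have "proj_face smul (exposed_points smul f)"
      by (intro proj_face_exposed_points)
    moreover have "F \<subset> exposed_points smul f" using sub y by blast
    ultimately show False using max unfolding maximal_proj_face_def by blast
  qed
  ultimately show "perp_bounded smul F \<and>
      (\<forall>y \<in> proj_space smul - F. \<not> perp_bounded smul (F \<union> {y}))" by blast
next
  assume *: "perp_bounded smul F \<and> (\<forall>y \<in> proj_space smul - F. \<not> perp_bounded smul (F \<union> {y}))"
  \<comment> \<open>Condition (i) passes to subcollections, so a strictly larger face would already
    allow the addition of a single point, against (ii).\<close>
  have no_larger: "F = F'" if F': "proj_face smul F'" "F \<subseteq> F'" for F'
  proof (rule ccontr)
    assume "F \<noteq> F'"
    then obtain y where y: "y \<in> F'" "y \<notin> F" using F'(2) by blast
    have "perp_bounded smul (F \<union> {y})"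
      using perp_bounded_mono[OF proj_face_perp_bounded[OF F'(1)]] F'(2) y(1) by simp
    moreover have "y \<in> proj_space smul" using F'(1) y(1) by (auto simp: proj_face_def)
    ultimately show False using * y(2) by blast
  qed
  from * obtain f where "contractive_functional smul f" "\<exists>u. norm u = 1 \<and> f u = 1"
    and "F \<subseteq> exposed_points smul f"
    using perp_bounded_imp_exposed assms by metis
  \<comment> \<open>\<open>F\<close> is not yet known to be a face, but \<open>no_larger\<close>
    identifies it with the exposed face that contains it.\<close>
  then have "proj_face smul F"
    using no_larger proj_face_exposed_points by metis
  with no_larger show "maximal_proj_face smul F"
    unfolding maximal_proj_face_def by blast
qed

end

section \<open>The real and the complex case\<close>

lemma supported_normed_space_real:
  fixes smul :: "real \<Rightarrow> 'a::real_normed_vector \<Rightarrow> 'a"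
  assumes "fin_dim_normed_space smul"
  shows "supported_normed_space smul"
proof -
  interpret V: fin_dim_normed_space smul by fact
  have smul: "smul r u = r *\<^sub>R u" for r u
    using V.smul_of_real[of r u] by simp
  show ?thesis
  proof
    fix z :: 'a assume z: "norm z = 1"
    obtain C where "finite C" "span C = (UNIV :: 'a set)"
      using finite_real_span[OF assms] by blast
    then obtain g where g: "linear g" "\<And>x. g x \<le> norm x" "g z = norm z"
      using real_supporting_functional[of C z] by blast
    have "\<bar>g x\<bar> \<le> norm x" for x
      using g(2)[of x] g(2)[of "- x"] by (simp add: linear_neg[OF g(1)] abs_le_iff)
    then show "\<exists>f. contractive_functional smul f \<and> f z = 1"
      using g z by (auto simp: contractive_functional_def smul linear_add linear_scale intro!: exI[of _ g])
  qed
qed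

lemma supported_normed_space_complex:
  fixes smul :: "complex \<Rightarrow> 'a::real_normed_vector \<Rightarrow> 'a"
  assumes "fin_dim_normed_space smul"
  shows "supported_normed_space smul"
proof -
  interpret V: fin_dim_normed_space smul by fact
  show ?thesis
  proof
    fix z :: 'a assume z: "norm z = 1"
    obtain C where "finite C" "span C = (UNIV :: 'a set)"
      using finite_real_span[OF assms] by blast
    then obtain g where g: "linear g" "\<And>x. g x \<le> norm x" "g z = norm z"
      using real_supporting_functional[of C z] by blast
    \<comment> \<open>The complex-linear functional with real part \<open>g\<close>:
      \<open>f x = g x - i g (i x)\<close>.\<close>
    define f where "f x = Complex (g x) (- g (smul \<i> x))" for x
    have smul_split: "smul c x = Re c *\<^sub>R x + Im c *\<^sub>R smul \<i> x" for c x
    proof -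
      have "smul c x = smul (of_real (Re c) + of_real (Im c) * \<i>) x"
        by (simp add: complex_eq mult.commute)
      then show ?thesis by (simp only: V.scale_left_distrib V.smul_of_real flip: V.scale_scale)
    qed
    have g_smul: "g (smul c x) = Re c * g x + Im c * g (smul \<i> x)" for c x
      by (subst smul_split) (simp add: linear_add[OF g(1)] linear_scale[OF g(1)])
    have add: "f (x + y) = f x + f y" for x y
      by (simp add: f_def V.scale_right_distrib linear_add[OF g(1)] complex_eq_iff)
    have scale: "f (smul c x) = c * f x" for c x
      by (simp add: f_def g_smul[of c] g_smul[of "\<i> * c"] complex_eq_iff)
    have le: "norm (f x) \<le> norm x" for x
    proof (cases "f x = 0")
      case False
      \<comment> \<open>A rotation making \<open>c * f x\<close> real and nonnegative, so that the
        bound on \<open>g\<close> at \<open>c x\<close> controls the modulus of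
        \<open>f x\<close>.\<close>
      define c where "c = cnj (f x) / of_real (norm (f x))"
      have "norm c = 1" using False by (simp add: c_def norm_divide)
      have "c * f x = of_real (norm (f x))"
        using False complex_norm_square[of "f x"]
        by (simp add: c_def nonzero_divide_eq_eq power2_eq_square mult.commute)
      then have "norm (f x) = Re (c * f x)" by simp
      also have "\<dots> = g (smul c x)"
        unfolding scale[symmetric] by (simp add: f_def)
      also have "\<dots> \<le> norm x"
        using g(2)[of "smul c x"] \<open>norm c = 1\<close> by (simp add: V.norm_smul)
      finally show ?thesis .
    qed simp
    have "Re (f z) = 1" by (simp add: f_def g(3) z)
    moreover have "norm (f z) \<le> 1" using le[of z] z by simp
    \<comment> \<open>The midpoint of \<open>f z\<close> and its conjugate is
      \<open>Re (f z) = 1\<close>, so extremality of 1 gives \<open>f z = 1\<close>.\<close>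
    ultimately have "f z = 1"
      using convex_combination_eq_1[of "f z" "cnj (f z)" "1 / 2"]
      by (simp add: complex_eq_iff)
    with add scale le show "\<exists>f. contractive_functional smul f \<and> f z = 1"
      by (auto simp: contractive_functional_def)
  qed
qed

theorem corollary2p11:
  fixes smulR :: "real \<Rightarrow> 'a::real_normed_vector \<Rightarrow> 'a"
    and smulC :: "complex \<Rightarrow> 'b::real_normed_vector \<Rightarrow> 'b"
  shows
    "(fin_dim_normed_space smulR \<longrightarrow>
       (let G = bj_graph smulR in
        \<forall>F \<subseteq> pverts G. maximal_proj_face smulR F \<longleftrightarrow>
          (\<exists>z \<in> pverts G. out_perp G z \<subseteq> (\<Inter>x\<in>F. out_perp G x)) \<and>
          (\<forall>y \<in> pverts G - F.
             \<not> (\<exists>z \<in> pverts G. out_perp G z \<subseteq> (\<Inter>x\<in>F \<union> {y}. out_perp G x))))) \<and>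
     (fin_dim_normed_space smulC \<longrightarrow>
       (let G = bj_graph smulC in
        \<forall>F \<subseteq> pverts G. maximal_proj_face smulC F \<longleftrightarrow>
          (\<exists>z \<in> pverts G. out_perp G z \<subseteq> (\<Inter>x\<in>F. out_perp G x)) \<and>
          (\<forall>y \<in> pverts G - F.
             \<not> (\<exists>z \<in> pverts G. out_perp G z \<subseteq> (\<Inter>x\<in>F \<union> {y}. out_perp G x)))))"
proof (intro conjI impI; unfold Let_def pverts_bj_graph; intro allI impI)
  fix F assume "fin_dim_normed_space smulR" and F: "F \<subseteq> proj_space smulR"
  then interpret supported_normed_space smulR
    by (intro supported_normed_space_real)
  show "maximal_proj_face smulR F \<longleftrightarrow>
      (\<exists>z \<in> proj_space smulR. out_perp (bj_graph smulR) z \<subseteq> (\<Inter>x\<in>F. out_perp (bj_graph smulR) x)) \<and>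
      (\<forall>y \<in> proj_space smulR - F.
         \<not> (\<exists>z \<in> proj_space smulR.
               out_perp (bj_graph smulR) z \<subseteq> (\<Inter>x\<in>F \<union> {y}. out_perp (bj_graph smulR) x)))"
    using maximal_proj_face_iff[OF F] unfolding perp_bounded_def pverts_bj_graph .
next
  fix F assume "fin_dim_normed_space smulC" and F: "F \<subseteq> proj_space smulC"
  then interpret supported_normed_space smulC
    by (intro supported_normed_space_complex)
  show "maximal_proj_face smulC F \<longleftrightarrow>
      (\<exists>z \<in> proj_space smulC. out_perp (bj_graph smulC) z \<subseteq> (\<Inter>x\<in>F. out_perp (bj_graph smulC) x)) \<and>
      (\<forall>y \<in> proj_space smulC - F.
         \<not> (\<exists>z \<in> proj_space smulC.
               out_perp (bj_graph smulC) z \<subseteq> (\<Inter>x\<in>F \<union> {y}. out_perp (bj_graph smulC) x)))"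
    using maximal_proj_face_iff[OF F] unfolding perp_bounded_def pverts_bj_graph .
qed

end
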